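(* Let $m\ge2$ and, for $n_1,\ldots,n_m\in\mathbb{N}_{\ge1}$, let $$\pi_1(n_1,\ldots,n_m)=\mathbb{P}(A_2\le n_2-1,\ldots,A_m\le n_m-1),$$ where $(A_2,\ldots,A_m)$ has a negative multinomial distribution with parameters $(n_1;p_2,\ldots,p_m)$, $p_\ell=\frac{n_\ell}{n_1+\cdots+n_m}$. Then, for fixed $n_2,\ldots,n_m\in\mathbb{N}_{\ge1}$, $$\lim_{n_1\to\infty}\pi_1(n_1,\ldots,n_m)=\prod_{k=2}^m\mathbb{P}(G_k>n_k),$$ where $G_\ell$ is $\operatorname{Gamma}(n_\ell,1)$-distributed, $\ell=2,\ldots,m$.
   Context: Negative multinomial distribution with parameters $(n_1;p_2,\ldots,p_m)$, with $p_1:=1-\sum_{k=2}^m p_k>0$: for all integers $k_2,\ldots,k_m\ge0$, $$\mathbb{P}(A_2=k_2,\ldots,A_m=k_m)=\frac{(n_1+k_2+\cdots+k_m-1)!}{(n_1-1)!\,k_2!\cdots k_m!}\,p_1^{n_1}\prod_{\ell=2}^m p_\ell^{k_\ell}.$$ $\operatorname{Gamma}(a,1)$ is the distribution on $(0,\infty)$ with density $x^{a-1}e^{-x}/\Gamma(a)$. *)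

theory Defs
  imports "HOL-Probability.Probability"
begin

text \<open>
  A vector indexed by the finite set \<open>I\<close> is represented by a function that vanishes outside \<open>I\<close>.
\<close>

definition neg_multinomial_mass ::
    "'i set \<Rightarrow> nat \<Rightarrow> ('i \<Rightarrow> real) \<Rightarrow> ('i \<Rightarrow> nat) \<Rightarrow> real" where
  "neg_multinomial_mass I r p k =
     (if \<forall>i. i \<notin> I \<longrightarrow> k i = 0
      then fact (r + (\<Sum>i\<in>I. k i) - 1) / (fact (r - 1) * (\<Prod>i\<in>I. fact (k i)))
             * (1 - (\<Sum>i\<in>I. p i)) ^ r * (\<Prod>i\<in>I. p i ^ k i)
      else 0)"

definition neg_multinomial_pmf ::
    "'i set \<Rightarrow> nat \<Rightarrow> ('i \<Rightarrow> real) \<Rightarrow> ('i \<Rightarrow> nat) pmf" where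
  "neg_multinomial_pmf I r p = embed_pmf (neg_multinomial_mass I r p)"

lemma neg_multinomial_mass_nonneg:
  assumes "\<And>i. i \<in> I \<Longrightarrow> p i \<ge> 0" "(\<Sum>i\<in>I. p i) < 1"
  shows "neg_multinomial_mass I r p k \<ge> 0"
  using assms unfolding neg_multinomial_mass_def
  by (auto intro!: mult_nonneg_nonneg divide_nonneg_nonneg prod_nonneg)

lemma neg_multinomial_mass_insert:
  assumes I: "finite I" "j \<notin> I" and p: "\<And>i. i \<in> insert j I \<Longrightarrow> p i \<ge> 0"
    and s: "(\<Sum>i\<in>insert j I. p i) < 1" and r: "r \<ge> 1"
    and k: "\<And>i. i \<notin> I \<Longrightarrow> k i = 0"
  shows "neg_multinomial_mass (insert j I) r p (k(j := a)) =
     pmf (neg_binomial_pmf r (1 - p j / (1 - (\<Sum>i\<in>I. p i)))) a * neg_multinomial_mass I (r + a) p k"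
proof -
  define q where "q = 1 - (\<Sum>i\<in>I. p i)"
  have q: "q > 0" "p j \<ge> 0" "p j < q"
    using s p[of j] I by (simp_all add: q_def)
  have e1: "(\<Sum>i\<in>I. if i = j then a else k i) = (\<Sum>i\<in>I. k i)"
    using I by (intro sum.cong) auto
  have e2: "(\<Prod>i\<in>I. fact (if i = j then a else k i)) = (\<Prod>i\<in>I. fact (k i) :: real)"
    using I by (intro prod.cong) auto
  have e3: "(\<Prod>i\<in>I. p i ^ (if i = j then a else k i)) = (\<Prod>i\<in>I. p i ^ k i)"
    using I by (intro prod.cong) auto
  have nb: "pmf (neg_binomial_pmf r (1 - p j / q)) a =
      real ((a + r - 1) choose a) * (1 - p j / q) ^ r * (p j / q) ^ a"
    using q by (subst pmf_neg_binomial) (auto simp: field_simps)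
  have ch: "real ((a + r - 1) choose a) = fact (r + a - 1) / (fact a * fact (r - 1))"
    using r by (subst binomial_fact) (auto simp: add.commute)
  have qq: "1 - p j / q = (q - p j) / q" using q by (simp add: field_simps)
  have nz: "fact (r + a - 1) \<noteq> (0::real)" "fact (r - 1) \<noteq> (0::real)"
     "fact a \<noteq> (0::real)" "(\<Prod>i\<in>I. fact (k i)) \<noteq> (0::real)" using I by auto
  have L: "neg_multinomial_mass (insert j I) r p (k(j := a)) =
      fact (r + a + (\<Sum>i\<in>I. k i) - 1) / (fact (r - 1) * (fact a * (\<Prod>i\<in>I. fact (k i))))
        * (q - p j) ^ r * (p j ^ a * (\<Prod>i\<in>I. p i ^ k i))"
    using I k by (auto simp: neg_multinomial_mass_def e1 e2 e3 q_def algebra_simps)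
  have R: "neg_multinomial_mass I (r + a) p k =
      fact (r + a + (\<Sum>i\<in>I. k i) - 1) / (fact (r + a - 1) * (\<Prod>i\<in>I. fact (k i)))
        * q ^ (r + a) * (\<Prod>i\<in>I. p i ^ k i)"
    using k by (simp add: neg_multinomial_mass_def q_def)
  show ?thesis
    unfolding q_def[symmetric] nb ch L R unfolding qq power_divide power_add
    using nz q(1) by (simp add: field_simps)
qed

lemma nn_integral_neg_multinomial_mass:
  assumes "finite I" "\<And>i. i \<in> I \<Longrightarrow> p i \<ge> 0" "(\<Sum>i\<in>I. p i) < 1" "r \<ge> 1"
  shows "(\<integral>\<^sup>+k. ennreal (neg_multinomial_mass I r p k) \<partial>count_space UNIV) = 1"
  using assms
proof (induction I arbitrary: r rule: finite_induct)
  case empty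
  have "(\<integral>\<^sup>+k. ennreal (neg_multinomial_mass {} r p k) \<partial>count_space UNIV)
      = (\<integral>\<^sup>+k. 1 * indicator {\<lambda>_ :: 'a. 0 :: nat} k \<partial>count_space UNIV)"
    by (intro nn_integral_cong) (auto simp: neg_multinomial_mass_def fun_eq_iff split: split_indicator)
  then show ?case by (simp add: nn_integral_cmult_indicator)
next
  case (insert j I)
  let ?V = "\<lambda>I. {k :: 'a \<Rightarrow> nat. \<forall>i. i \<notin> I \<longrightarrow> k i = 0}"
  let ?nb = "pmf (neg_binomial_pmf r (1 - p j / (1 - (\<Sum>i\<in>I. p i))))"
  have pI: "\<And>i. i \<in> I \<Longrightarrow> p i \<ge> 0" and sI: "(\<Sum>i\<in>I. p i) < 1"
  proof -
    show "\<And>i. i \<in> I \<Longrightarrow> p i \<ge> 0" using insert.prems by auto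
    have "p j \<ge> 0" using insert.prems by auto
    then show "(\<Sum>i\<in>I. p i) < 1" using insert.prems(2) insert.hyps by simp
  qed
  have restrict: "(\<integral>\<^sup>+k. ennreal (neg_multinomial_mass J s p k) \<partial>count_space UNIV)
      = (\<integral>\<^sup>+k. ennreal (neg_multinomial_mass J s p k) \<partial>count_space (?V J))" for J s
    by (rule nn_integral_count_space_eq) (auto simp: neg_multinomial_mass_def)
  have bij: "bij_betw (\<lambda>(a, k). k(j := a)) (UNIV \<times> ?V I) (?V (insert j I))"
  proof (rule bij_betw_byWitness[where f' = "\<lambda>k. (k j, k(j := 0))"])
  qed (use insert.hyps in \<open>auto simp: fun_eq_iff\<close>)
  have "(\<integral>\<^sup>+k. ennreal (neg_multinomial_mass (insert j I) r p k) \<partial>count_space UNIV)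
     = (\<integral>\<^sup>+x. ennreal (neg_multinomial_mass (insert j I) r p (case x of (a, k) \<Rightarrow> k(j := a)))
          \<partial>count_space (UNIV \<times> ?V I))"
    unfolding restrict by (rule nn_integral_bij_count_space[OF bij, symmetric])
  also have "\<dots> = (\<integral>\<^sup>+x. (case x of (a, k) \<Rightarrow>
        ennreal (?nb a) * ennreal (neg_multinomial_mass I (r + a) p k))
          \<partial>count_space (UNIV \<times> ?V I))"
  proof (rule nn_integral_cong, clarsimp)
    fix a and k :: "'a \<Rightarrow> nat" assume k: "\<forall>i. i \<notin> I \<longrightarrow> k i = 0"
    show "ennreal (neg_multinomial_mass (insert j I) r p (k(j := a))) =
       ennreal (?nb a) * ennreal (neg_multinomial_mass I (r + a) p k)"
      using k by (subst neg_multinomial_mass_insert[OF insert.hyps insert.prems])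
         (auto simp: ennreal_mult'' neg_multinomial_mass_nonneg[OF pI sI])
  qed
  also have "\<dots> = (\<integral>\<^sup>+x. (case x of (a, k) \<Rightarrow>
        ennreal (?nb a) * ennreal (neg_multinomial_mass I (r + a) p k)) \<partial>count_space UNIV)"
    by (rule nn_integral_count_space_eq) (auto simp: neg_multinomial_mass_def split: if_splits)
  also have "\<dots> = (\<integral>\<^sup>+a. (\<integral>\<^sup>+k. ennreal (?nb a) * ennreal (neg_multinomial_mass I (r + a) p k)
        \<partial>count_space UNIV) \<partial>count_space UNIV)"
    by (subst nn_integral_fst_count_space[symmetric]) simp
  also have "\<dots> = (\<integral>\<^sup>+a. ennreal (?nb a) \<partial>count_space UNIV)"
    using insert.IH[OF pI sI] insert.prems(3) by (simp add: nn_integral_cmult)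
  also have "\<dots> = 1" by (rule nn_integral_pmf_eq_1)
  finally show ?case .
qed

lemma pmf_neg_multinomial:
  assumes "finite I" "\<And>i. i \<in> I \<Longrightarrow> p i \<ge> 0" "(\<Sum>i\<in>I. p i) < 1" "r \<ge> 1"
  shows "pmf (neg_multinomial_pmf I r p) k = neg_multinomial_mass I r p k"
  unfolding neg_multinomial_pmf_def
  by (rule pmf_embed_pmf[OF neg_multinomial_mass_nonneg nn_integral_neg_multinomial_mass])
     (use assms in auto)

text \<open>
  Only the components \<open>n 1, \<dots>, n m\<close> matter. For \<open>n l \<ge> 1\<close> the natural-number subtraction
  \<open>n l - 1\<close> is the true one.
\<close>

definition pi1 :: "nat \<Rightarrow> (nat \<Rightarrow> nat) \<Rightarrow> real" where
  "pi1 m n =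
     measure_pmf.prob
       (neg_multinomial_pmf {2..m} (n 1) (\<lambda>l. real (n l) / real (\<Sum>j = 1..m. n j)))
       {a. \<forall>l\<in>{2..m}. a l \<le> n l - 1}"

definition gamma_density :: "real \<Rightarrow> real \<Rightarrow> real" where
  "gamma_density a x = (if x > 0 then x powr (a - 1) * exp (- x) / Gamma a else 0)"

lemma borel_measurable_gamma_density [measurable]: "gamma_density a \<in> borel_measurable borel"
  unfolding gamma_density_def[abs_def] by measurable

lemma prob_space_gamma_density:
  assumes a: "a > 0"
  shows "prob_space (density lborel (gamma_density a))"
proof
  have "((\<lambda>t. t powr (a - 1) / exp t / Gamma a) has_integral Gamma a / Gamma a) {0..}"
    by (intro has_integral_divide Gamma_integral_real a)
  then have "((\<lambda>t. t powr (a - 1) / exp t / Gamma a) has_integral 1) {0..}"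
    using Gamma_real_pos[OF a] by simp
  then have "(gamma_density a has_integral 1) {0..}"
    by (rule has_integral_spike[of "{0}", rotated 2])
       (auto simp: gamma_density_def exp_minus field_simps)
  then have "(gamma_density a has_integral 1) UNIV"
    by (rule has_integral_on_superset) (auto simp: gamma_density_def)
  moreover have "gamma_density a x \<ge> 0" for x
    using Gamma_real_pos[OF a] by (auto simp: gamma_density_def)
  ultimately have "(\<integral>\<^sup>+x. ennreal (gamma_density a x) \<partial>lborel) = 1"
    by (subst nn_integral_has_integral_lborel) auto
  then show "emeasure (density lborel (gamma_density a)) (space (density lborel (gamma_density a))) = 1"
    by (simp add: emeasure_density)
qed

end

(*
  As r tends to infinity, the negative multinomial mass with parameters r and
  p i = c i / (r + N), N = sum c, converges pointwise to a product of Poisson masses with means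
  c i: the quotient (r + K - 1)! / (r - 1)! is of order (r + N)^K, and (r / (r + N))^r tends to
  exp (-N). Only finitely many vectors contribute to the event in question, so the probability
  converges to a product of Poisson distribution functions, and the tail of a Gamma law with
  integer parameter is such a function (Erlang).
*)
theory Submission
  imports Defs "HOL-Real_Asymp.Real_Asymp"
begin

text \<open>With \<open>K\<close> fixed, both the rising factorial and the power are products of
  \<open>K\<close> factors; they are paired off, and each quotient tends to 1.\<close>

lemma tendsto_pochhammer_over_power:
  "(\<lambda>r. pochhammer (real r) K / (real r + N) ^ K) \<longlonglongrightarrow> 1"
proof -
  have "(\<lambda>r. (real r + real i) / (real r + N)) \<longlonglongrightarrow> 1" for i
    by real_asymp
  then have "(\<lambda>r. \<Prod>i<K. (real r + real i) / (real r + N)) \<longlonglongrightarrow> (\<Prod>i<K. 1)"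
    by (rule tendsto_prod)
  then show ?thesis
    by (simp add: pochhammer_prod prod_dividef atLeast0LessThan)
qed

lemma tendsto_ratio_power_exp: "(\<lambda>r. (real r / (real r + N)) ^ r) \<longlonglongrightarrow> exp (- N)"
proof -
  have "(\<lambda>r. inverse ((1 + N / real r) ^ r)) \<longlonglongrightarrow> inverse (exp N)"
    by (intro tendsto_inverse tendsto_exp_limit_sequentially) simp
  moreover have "\<forall>\<^sub>F r in sequentially. inverse ((1 + N / real r) ^ r) = (real r / (real r + N)) ^ r"
    using eventually_gt_at_top[of 0]
    by eventually_elim (simp flip: power_inverse add: field_simps)
  ultimately show ?thesis
    unfolding exp_minus by (rule Lim_transform_eventually)
qed

lemma fact_quotient_eq_pochhammer:
  assumes "r \<ge> 1"
  shows "fact (r + K - 1) / fact (r - 1) = pochhammer (real r) K"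
proof -
  obtain s where s: "r = Suc s" using assms by (cases r) auto
  show ?thesis
    \<comment> \<open>\<open>(s + K)!\<close> is the rising factorial of 1 of length
      \<open>s + K\<close>; splitting it after \<open>s\<close> factors leaves the one that starts
      at \<open>s + 1 = r\<close>.\<close>
    using pochhammer_product'[of "1 :: real" s K] by (simp add: s field_simps flip: pochhammer_fact)
qed

lemma neg_multinomial_mass_tendsto_poisson:
  fixes c :: "'i \<Rightarrow> real"
  assumes I: "finite I" and k: "\<And>i. i \<notin> I \<Longrightarrow> k i = 0"
  shows "(\<lambda>r. neg_multinomial_mass I r (\<lambda>i. c i / (real r + sum c I)) k)
           \<longlonglongrightarrow> (\<Prod>i\<in>I. c i ^ k i * exp (- c i) / fact (k i))"
proof -
  define N where "N = sum c I"
  define K where "K = sum k I"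
  let ?C = "\<Prod>i\<in>I. c i ^ k i / fact (k i)"
  have "(\<lambda>r. pochhammer (real r) K / (real r + N) ^ K * (real r / (real r + N)) ^ r * ?C)
          \<longlonglongrightarrow> 1 * exp (- N) * ?C"
    by (intro tendsto_mult tendsto_const tendsto_pochhammer_over_power tendsto_ratio_power_exp)
  moreover have "\<forall>\<^sub>F r in sequentially.
      pochhammer (real r) K / (real r + N) ^ K * (real r / (real r + N)) ^ r * ?C =
      neg_multinomial_mass I r (\<lambda>i. c i / (real r + N)) k"
    \<comment> \<open>The signs of the \<open>c i\<close> are not restricted here, so
      \<open>N\<close> may be negative; this bound forces \<open>r + N > 0\<close> as well as
      \<open>r \<ge> 1\<close>.\<close>
    using eventually_gt_at_top[of "nat \<lceil>\<bar>N\<bar>\<rceil>"]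
  proof eventually_elim
    case (elim r)
    then have r: "r \<ge> 1" and pos: "real r + N > 0" by linarith+
    have "1 - (\<Sum>i\<in>I. c i / (real r + N)) = real r / (real r + N)"
      using pos by (simp add: N_def field_simps flip: sum_divide_distrib)
    moreover have "(\<Prod>i\<in>I. (c i / (real r + N)) ^ k i) = (\<Prod>i\<in>I. c i ^ k i) / (real r + N) ^ K"
      by (simp add: power_divide prod_dividef power_sum K_def)
    ultimately show ?case
      using k by (simp add: neg_multinomial_mass_def prod_dividef mult_ac
          flip: K_def fact_quotient_eq_pochhammer[OF r])
  qed
  ultimately have "(\<lambda>r. neg_multinomial_mass I r (\<lambda>i. c i / (real r + N)) k) \<longlonglongrightarrow> 1 * exp (- N) * ?C"
    by (rule Lim_transform_eventually)
  moreover have "1 * exp (- N) * ?C = (\<Prod>i\<in>I. c i ^ k i * exp (- c i) / fact (k i))"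
    by (simp add: N_def exp_sum[OF I] sum_negf[symmetric] prod.distrib prod_dividef mult_ac
        del: sum_negf)
  ultimately show ?thesis by (simp add: N_def)
qed

text \<open>Distributivity, transported from \<open>PiE\<close>, whose functions are
  \<open>undefined\<close> outside \<open>A\<close>, to functions with default \<open>d\<close>
  there. The masses live on vectors that are 0 outside the index set, so the case
  \<open>d = 0\<close> is the one applied.\<close>

lemma sum_prod_PiE_dflt:
  fixes f :: "'a \<Rightarrow> 'b \<Rightarrow> 'c :: comm_semiring_1"
  assumes "finite A" "\<And>x. x \<in> A \<Longrightarrow> finite (B x)"
  shows "(\<Sum>g\<in>PiE_dflt A d B. \<Prod>x\<in>A. f x (g x)) = (\<Prod>x\<in>A. \<Sum>y\<in>B x. f x y)"
proof -
  let ?F = "\<lambda>h x. if x \<in> A then h x else d"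
  have "inj_on ?F (PiE A B)"
    by (rule inj_on_inverseI[where g = "\<lambda>h. restrict h A"])
       (auto simp: PiE_def extensional_def restrict_def fun_eq_iff)
  then have "(\<Sum>g\<in>PiE_dflt A d B. \<Prod>x\<in>A. f x (g x)) = (\<Sum>h\<in>PiE A B. \<Prod>x\<in>A. f x (?F h x))"
    by (simp add: sum.reindex flip: dflt_image_PiE cong: prod.cong)
  also have "\<dots> = (\<Prod>x\<in>A. \<Sum>y\<in>B x. f x y)"
    by (simp add: prod_sum_PiE assms cong: prod.cong)
  finally show ?thesis .
qed

lemma neg_multinomial_prob_tendsto:
  fixes c :: "'i \<Rightarrow> real" and b :: "'i \<Rightarrow> nat"
  assumes I: "finite I" and c: "\<And>i. i \<in> I \<Longrightarrow> c i \<ge> 0"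
  shows "(\<lambda>r. measure_pmf.prob (neg_multinomial_pmf I r (\<lambda>i. c i / (real r + sum c I)))
                {a. \<forall>i\<in>I. a i \<le> b i})
           \<longlonglongrightarrow> (\<Prod>i\<in>I. \<Sum>j\<le>b i. c i ^ j * exp (- c i) / fact j)"
proof -
  let ?F = "PiE_dflt I 0 (\<lambda>i. {..b i})"
  let ?p = "\<lambda>r i. c i / (real r + sum c I)"
  have F: "finite ?F" using I by auto
  have "(\<lambda>r. \<Sum>k\<in>?F. neg_multinomial_mass I r (?p r) k)
          \<longlonglongrightarrow> (\<Sum>k\<in>?F. \<Prod>i\<in>I. c i ^ k i * exp (- c i) / fact (k i))"
    by (intro tendsto_sum neg_multinomial_mass_tendsto_poisson I) (auto simp: PiE_dflt_def)
  then have "(\<lambda>r. \<Sum>k\<in>?F. neg_multinomial_mass I r (?p r) k)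
          \<longlonglongrightarrow> (\<Prod>i\<in>I. \<Sum>j\<le>b i. c i ^ j * exp (- c i) / fact j)"
    using I by (simp add: sum_prod_PiE_dflt[where f = "\<lambda>i j. c i ^ j * exp (- c i) / fact j"])
  moreover have "\<forall>\<^sub>F r in sequentially. (\<Sum>k\<in>?F. neg_multinomial_mass I r (?p r) k) =
      measure_pmf.prob (neg_multinomial_pmf I r (?p r)) {a. \<forall>i\<in>I. a i \<le> b i}"
    \<comment> \<open>For \<open>r \<ge> 1\<close> the parameters sum to
      \<open>N / (r + N) < 1\<close> with \<open>N = sum c I \<ge> 0\<close>, so
      \<open>pmf_neg_multinomial\<close> applies.\<close>
    using eventually_ge_at_top[of 1]
  proof eventually_elim
    case (elim r)
    have N: "sum c I \<ge> 0" using c by (rule sum_nonneg)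
    have "sum (?p r) I < 1"
      using N elim by (simp add: field_simps flip: sum_divide_distrib)
    moreover have "?p r i \<ge> 0" if "i \<in> I" for i
      using c[OF that] N by simp
    ultimately have pmf: "pmf (neg_multinomial_pmf I r (?p r)) k = neg_multinomial_mass I r (?p r) k" for k
      using I elim by (intro pmf_neg_multinomial) auto
    \<comment> \<open>The event leaves coordinates outside \<open>I\<close> free, but vectors that
      are nonzero there have mass 0; the finite box \<open>?F\<close> therefore carries the same
      probability.\<close>
    have "measure_pmf.prob (neg_multinomial_pmf I r (?p r)) {a. \<forall>i\<in>I. a i \<le> b i} =
        measure_pmf.prob (neg_multinomial_pmf I r (?p r)) ?F"
      by (rule measure_prob_cong_0) (auto simp: pmf neg_multinomial_mass_def PiE_dflt_def)
    then show ?case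
      by (simp add: measure_measure_pmf_finite[OF F] pmf)
  qed
  ultimately show ?thesis by (rule Lim_transform_eventually)
qed

(* The two densities differ at x = 0 when s = 1. *)
lemma gamma_density_AE_erlang_density:
  assumes "s \<ge> 1"
  shows "AE x in lborel. gamma_density (real s) x = erlang_density (s - 1) 1 x"
proof -
  obtain t where t: "s = Suc t" using assms by (cases s) auto
  have "gamma_density (real s) x = erlang_density (s - 1) 1 x" if "x \<noteq> 0" for x
    using that Gamma_fact[of t, where 'a = real]
    by (auto simp: gamma_density_def erlang_density_def t powr_realpow add.commute)
  then show ?thesis
    using AE_lborel_singleton[of 0] by (auto elim: eventually_mono)
qed

text \<open>In a Poisson process of rate 1, the \<open>s\<close>-th arrival comes after time
  \<open>a\<close> exactly when at most \<open>s - 1\<close> arrivals occur by time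
  \<open>a\<close>.\<close>

lemma (in prob_space) gamma_distributed_gt:
  assumes D: "distributed M lborel X (gamma_density (real s))" and s: "s \<ge> 1" and a: "a \<ge> 0"
  shows "\<P>(x in M. X x > a) = (\<Sum>j\<le>s - 1. a ^ j * exp (- a) / fact j)"
proof -
  have "AE x in lborel. ennreal (gamma_density (real s) x) = ennreal (erlang_density (s - 1) 1 x)"
    using gamma_density_AE_erlang_density[OF s] by eventually_elim simp
  then have "distributed M lborel X (erlang_density (s - 1) 1)"
    using D by (subst (asm) distributed_cong_density) auto
  then show ?thesis
    using a by (subst erlang_distributed_gt) (auto simp: erlang_CDF_def)
qed

theorem theorem23:
  fixes m :: nat and n :: "nat \<Rightarrow> nat"
    and M :: "nat \<Rightarrow> 'a measure" and G :: "nat \<Rightarrow> 'a \<Rightarrow> real"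
  assumes "m \<ge> 2"
    and "\<And>l. l \<in> {2..m} \<Longrightarrow> n l \<ge> 1"
    and "\<And>l. l \<in> {2..m} \<Longrightarrow> prob_space (M l)"
    and "\<And>l. l \<in> {2..m} \<Longrightarrow> distributed (M l) lborel (G l) (gamma_density (real (n l)))"
  shows "(\<lambda>n1. pi1 m (n(1 := n1))) \<longlonglongrightarrow>
           (\<Prod>k = 2..m. \<P>(x in M k. G k x > real (n k)))"
proof -
  let ?I = "{2..m}"
  let ?c = "\<lambda>i. real (n i)"
  have split: "{1..m} = insert 1 ?I" using assms(1) by auto
  have total: "real (\<Sum>j = 1..m. (n(1 := r)) j) = real r + sum ?c ?I" for r
  proof -
    have "sum (n(1 := r)) ?I = sum n ?I" by (rule sum.cong) auto
    then show ?thesis unfolding split by (subst sum.insert) auto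
  qed
  \<comment> \<open>The two parameter functions can differ at index 1. Since 1 is outside
    \<open>{2..m}\<close>, the masses agree, and hence so do the distributions embedded from
    them.\<close>
  have mass: "neg_multinomial_mass ?I r (\<lambda>l. real ((n(1 := r)) l) / (real r + sum ?c ?I)) =
      neg_multinomial_mass ?I r (\<lambda>l. ?c l / (real r + sum ?c ?I))" for r
    by (auto simp: neg_multinomial_mass_def fun_eq_iff)
  have "pi1 m (n(1 := r)) =
      measure_pmf.prob (neg_multinomial_pmf ?I r (\<lambda>l. ?c l / (real r + sum ?c ?I)))
        {a. \<forall>l\<in>?I. a l \<le> n l - 1}" for r
    unfolding pi1_def total neg_multinomial_pmf_def fun_upd_same mass
    by (rule arg_cong[where f = "measure_pmf.prob _"]) auto
  moreover have "(\<Prod>k\<in>?I. \<P>(x in M k. G k x > ?c k)) =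
      (\<Prod>k\<in>?I. \<Sum>j\<le>n k - 1. ?c k ^ j * exp (- ?c k) / fact j)"
    using assms(2-4) by (intro prod.cong refl prob_space.gamma_distributed_gt) auto
  ultimately show ?thesis
    \<comment> \<open>Each \<open>n l\<close> is both the Poisson mean and, lowered by one, the
      cutoff; this matches the Erlang tail of shape \<open>n l\<close> at the point
      \<open>n l\<close>.\<close>
    using neg_multinomial_prob_tendsto[of ?I ?c "\<lambda>l. n l - 1"] by simp
qed

end
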